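(* The genuinely multipartite concurrence $C_{gme}$ does not satisfy the hierarchy condition, and hence is not a complete genuine multipartite entanglement measure.
   Context: $\mathcal{H}^{A_1\cdots A_m}=\mathcal{H}^{A_1}\otimes\cdots\otimes\mathcal{H}^{A_m}$ is an $m$-partite Hilbert space of finite dimension; $\mathcal{S}^{X}$ is the set of density operators on $\mathcal{H}^X$. The genuinely multipartite concurrence is, for a pure state $|\psi\rangle\in\mathcal{H}^{A_1\cdots A_m}$, $$C_{gme}(|\psi\rangle):=\min_{\gamma_i\in\gamma}\sqrt{2\left[1-\mathrm{Tr}\left(\rho^{A_{\gamma_i}}\right)^2\right]},$$ where $\gamma=\{\gamma_i\}$ is the set of all bipartitions of $A_1\cdots A_m$ and $\rho^{A_{\gamma_i}}$ is the reduced state of $|\psi\rangle\langle\psi|$ on one side of the bipartition $\gamma_i$; for mixed states it is defined by the convex-roof extension (minimum of $\sum_ip_iC_{gme}(|\psi_i\rangle)$ over pure-state decompositions). It is defined by this expression for every number $k\ge2$ of parties; for $k=2$ it is the bipartite concurrence $C$. Partitions. A $k$-partition $X_1|\cdots|X_k$ of $A_1\cdots A_m$ (or of a subsystem) splits the parties into $k$ blocks. Write $X_1|\cdots|X_k\succ^a Y_1|\cdots|Y_l$ if the second is obtained from the first by discarding some subsystem(s) (e.g. $A|B|C|D\succ^a A|B|D$), and $X_1|\cdots|X_k\succ^b Y_1|\cdots|Y_l$ if it is obtained by combining some subsystems (e.g. $A|B|C|D\succ^b AC|B|D\succ^b AC|BD$). For a state $\rho$, $E_g^{(k)}(X_1|\cdots|X_k)$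 denotes $E_g^{(k)}$ evaluated on the reduced state $\rho^{X_1\cdots X_k}$ regarded as a $k$-partite state with parties $X_1,\dots,X_k$. A pure state is biseparable if it is a product state across some bipartition of the parties; a mixed state is biseparable if it is a convex combination of biseparable pure states (possibly with respect to different bipartitions). Otherwise it is genuinely entangled. $\mathcal{S}_g^{A_1\cdots A_m}$ is the set of genuinely entangled states. $E_g^{(m)}:\mathcal{S}^{A_1\cdots A_m}\to\mathbb{R}_+$ is a genuine multipartite entanglement measure (GMEM) if it vanishes on biseparable states, is positive on genuinely entangled states (this may be weakened to nonnegativity), is convex, and does not increase under $m$-partite LOCC. It is uniform if $E_g^{(k)}$ is uniquely determined by $E_g^{(m)}$ for every $2\le k<m$. A uniform GMEM is unified if it is invariant under permutations of the subsystems and $E_g^{(k)}(X_1|\cdots|X_k)>E_g^{(l)}(Y_1|\cdots|Y_l)$ for any $\rho\in\mathcal{S}_g^{A_1\cdots A_m}$ whenever $X_1|\cdots|X_k\succ^a Y_1|\cdots|Y_l$. A unified GMEM is complete if it satisfies the hierarchy condition: $E_g^{(k)}(X_1|\cdots|X_k)\ge E_g^{(l)}(Y_1|\cdots|Y_l)$ for any $\rho\in\mathcal{S}_g^{A_1\cdots A_m}$ whenever $X_1|\cdots|X_k\succ^b Y_1|\cdots|Y_l$. *)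

theory Defs
  imports
    Complex_Main
    "HOL-Library.FuncSet"
    "HOL-Library.Countable_Set"
    "HOL-Library.Disjoint_Sets"
    "HOL-Library.Nonpos_Ints"
    "HOL-Combinatorics.Permutations"
begin

section \<open>Multipartite states\<close>

text \<open>
  A multipartite system is given by the list \<open>ds\<close> of its local dimensions. Its parties are the
  numbers below \<open>length ds\<close>, and party \<open>i\<close> has Hilbert space of dimension \<open>ds ! i\<close>. Product basis
  vectors of the subsystem formed by a set \<open>S\<close> of parties are indexed by \<open>basis ds S\<close>. Kets and
  operators are represented by their coefficients in the product basis and vanish off the basis.
\<close>

type_synonym mindex = "nat \<Rightarrow> nat"
type_synonym ket = "mindex \<Rightarrow> complex"
type_synonym oper = "mindex \<Rightarrow> mindex \<Rightarrow> complex"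

definition parties :: "nat list \<Rightarrow> nat set" where
  "parties ds = {..<length ds}"

definition basis :: "nat list \<Rightarrow> nat set \<Rightarrow> mindex set" where
  "basis ds S = (\<Pi>\<^sub>E i\<in>S. {..<ds ! i})"

definition pure_states :: "nat list \<Rightarrow> ket set" where
  "pure_states ds = {\<psi>. (\<forall>x. x \<notin> basis ds (parties ds) \<longrightarrow> \<psi> x = 0)
     \<and> (\<Sum>x\<in>basis ds (parties ds). (cmod (\<psi> x))\<^sup>2) = 1}"

definition proj :: "ket \<Rightarrow> oper" where
  "proj \<psi> = (\<lambda>x y. \<psi> x * cnj (\<psi> y))"

definition positive_oper :: "nat list \<Rightarrow> oper \<Rightarrow> bool" where
  "positive_oper ds \<rho> \<longleftrightarrow> (\<forall>v :: ket.
     (\<Sum>x\<in>basis ds (parties ds). \<Sum>y\<in>basis ds (parties ds). cnj (v x) * \<rho> x y * v y) \<in> \<real>\<^sub>\<ge>\<^sub>0)"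

definition density_ops :: "nat list \<Rightarrow> oper set" where
  "density_ops ds = {\<rho>. (\<forall>x y. x \<notin> basis ds (parties ds) \<or> y \<notin> basis ds (parties ds) \<longrightarrow> \<rho> x y = 0)
     \<and> positive_oper ds \<rho> \<and> (\<Sum>x\<in>basis ds (parties ds). \<rho> x x) = 1}"

text \<open>Partial trace over the parties outside \<open>S\<close>.\<close>

definition reduced :: "nat list \<Rightarrow> nat set \<Rightarrow> oper \<Rightarrow> oper" where
  "reduced ds S \<rho> = (\<lambda>x y. if x \<in> basis ds S \<and> y \<in> basis ds S
     then (\<Sum>z\<in>basis ds (parties ds - S). \<rho> (override_on z x S) (override_on z y S)) else 0)"

definition purity :: "nat list \<Rightarrow> nat set \<Rightarrow> oper \<Rightarrow> real" where
  "purity ds S \<sigma> = Re (\<Sum>x\<in>basis ds S. \<Sum>y\<in>basis ds S. \<sigma> x y * \<sigma> y x)"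

text \<open>A bipartition is represented by one of its two sides, so every bipartition occurs twice.\<close>

definition bipartitions :: "nat list \<Rightarrow> nat set set" where
  "bipartitions ds = {S. S \<noteq> {} \<and> S \<subset> parties ds}"

definition pure_ensemble :: "nat list \<Rightarrow> oper \<Rightarrow> nat \<Rightarrow> (nat \<Rightarrow> real) \<Rightarrow> (nat \<Rightarrow> ket) \<Rightarrow> bool" where
  "pure_ensemble ds \<rho> n p \<psi> \<longleftrightarrow>
     (\<forall>i<n. 0 \<le> p i \<and> \<psi> i \<in> pure_states ds) \<and> (\<Sum>i<n. p i) = 1
     \<and> \<rho> = (\<lambda>x y. \<Sum>i<n. of_real (p i) * proj (\<psi> i) x y)"

definition biseparable_pure :: "nat list \<Rightarrow> ket \<Rightarrow> bool" where
  "biseparable_pure ds \<psi> \<longleftrightarrow> \<psi> \<in> pure_states ds \<and>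
     (\<exists>S\<in>bipartitions ds. \<exists>\<phi> \<chi> :: ket. \<forall>x\<in>basis ds (parties ds).
        \<psi> x = \<phi> (restrict x S) * \<chi> (restrict x (parties ds - S)))"

definition biseparable :: "nat list \<Rightarrow> oper \<Rightarrow> bool" where
  "biseparable ds \<rho> \<longleftrightarrow>
     (\<exists>n p \<psi>. pure_ensemble ds \<rho> n p \<psi> \<and> (\<forall>i<n. biseparable_pure ds (\<psi> i)))"

definition genuinely_entangled :: "nat list \<Rightarrow> oper set" where
  "genuinely_entangled ds = {\<rho> \<in> density_ops ds. \<not> biseparable ds \<rho>}"


section \<open>Genuinely multipartite concurrence\<close>

definition C_gme_pure :: "nat list \<Rightarrow> ket \<Rightarrow> real" where
  "C_gme_pure ds \<psi> =
     Min ((\<lambda>S. sqrt (2 * (1 - purity ds S (reduced ds S (proj \<psi>))))) ` bipartitions ds)"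

text \<open>The convex roof is written as an infimum; by compactness it is attained.\<close>

definition C_gme :: "nat list \<Rightarrow> oper \<Rightarrow> real" where
  "C_gme ds \<rho> = Inf {(\<Sum>i<n. p i * C_gme_pure ds (\<psi> i)) | n p \<psi>. pure_ensemble ds \<rho> n p \<psi>}"


section \<open>Partitions into blocks of parties\<close>

text \<open>\<open>X\<close> lists the blocks of a partition of the whole system or of a subsystem.\<close>

definition party_partition :: "nat list \<Rightarrow> nat set list \<Rightarrow> bool" where
  "party_partition ds X \<longleftrightarrow>
     distinct X \<and> partition_on (\<Union>(set X)) (set X) \<and> \<Union>(set X) \<subseteq> parties ds"

definition discards :: "nat set list \<Rightarrow> nat set list \<Rightarrow> bool"  (infix \<open>\<succ>a\<close> 50) where
  "X \<succ>a Y \<longleftrightarrow> set Y \<subset> set X"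

definition combines :: "nat set list \<Rightarrow> nat set list \<Rightarrow> bool"  (infix \<open>\<succ>b\<close> 50) where
  "X \<succ>b Y \<longleftrightarrow> refines (\<Union>(set X)) (set X) (set Y) \<and> set X \<noteq> set Y"

text \<open>
  \<open>group_state ds X \<rho>\<close> is the reduced state of \<open>\<rho>\<close> on the parties occurring in \<open>X\<close>, regarded as a
  state of \<open>length X\<close> parties with local dimensions \<open>group_dims ds X\<close>. The Hilbert space of a block
  is identified with a coordinate space by enumerating its product basis; another enumeration
  changes the result by a local unitary only.
\<close>

definition group_dims :: "nat list \<Rightarrow> nat set list \<Rightarrow> nat list" where
  "group_dims ds X = map (\<lambda>B. \<Prod>i\<in>B. ds ! i) X"

definition block_index :: "nat set list \<Rightarrow> nat \<Rightarrow> nat" where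
  "block_index X i = (THE j. j < length X \<and> i \<in> X ! j)"

definition ungroup :: "nat list \<Rightarrow> nat set list \<Rightarrow> mindex \<Rightarrow> mindex" where
  "ungroup ds X x = (\<lambda>i\<in>\<Union>(set X).
     from_nat_into (basis ds (X ! block_index X i)) (x (block_index X i)) i)"

definition group_state :: "nat list \<Rightarrow> nat set list \<Rightarrow> oper \<Rightarrow> oper" where
  "group_state ds X \<rho> = (\<lambda>x y.
     let B = basis (group_dims ds X) (parties (group_dims ds X)) in
     if x \<in> B \<and> y \<in> B
     then reduced ds (\<Union>(set X)) \<rho> (ungroup ds X x) (ungroup ds X y) else 0)"


section \<open>LOCC\<close>

text \<open>\<open>local_op ds i e K \<rho>\<close> applies \<open>K \<rho> K\<^sup>\<dagger>\<close> at party \<open>i\<close>, where \<open>K a b\<close> is the entry in row \<open>a < e\<close>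
  and column \<open>b < ds ! i\<close>.\<close>

definition local_op :: "nat list \<Rightarrow> nat \<Rightarrow> nat \<Rightarrow> (nat \<Rightarrow> nat \<Rightarrow> complex) \<Rightarrow> oper \<Rightarrow> oper" where
  "local_op ds i e K \<rho> = (\<lambda>x y.
     let B = basis (ds[i := e]) (parties ds) in
     if x \<in> B \<and> y \<in> B
     then (\<Sum>b<ds ! i. \<Sum>c<ds ! i. K (x i) b * \<rho> (x(i := b)) (y(i := c)) * cnj (K (y i) c)) else 0)"

definition local_measurement ::
  "nat \<Rightarrow> nat \<Rightarrow> (nat \<Rightarrow> nat) \<Rightarrow> (nat \<Rightarrow> nat \<Rightarrow> nat \<Rightarrow> complex) \<Rightarrow> bool" where
  "local_measurement d r e K \<longleftrightarrow> (\<forall>j<r. 0 < e j) \<and>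
     (\<forall>b<d. \<forall>c<d. (\<Sum>j<r. \<Sum>a<e j. cnj (K j a b) * K j a c) = (if b = c then 1 else 0))"

text \<open>
  LOCC channels with finitely many rounds: in each round one party measures and broadcasts the
  outcome \<open>j\<close>, on which the remaining protocol \<open>\<Lambda> j\<close> may depend; in the end outcomes are forgotten.
\<close>

inductive locc :: "nat list \<Rightarrow> nat list \<Rightarrow> (oper \<Rightarrow> oper) \<Rightarrow> bool" where
  locc_id: "locc ds ds (\<lambda>\<rho>. \<rho>)"
| locc_round: "locc ds ds' (\<lambda>\<rho> x y. \<Sum>j<r. \<Lambda> j (local_op ds i (e j) (K j) \<rho>) x y)"
    if "i < length ds" and "local_measurement (ds ! i) r e K"
    and "\<And>j. j < r \<Longrightarrow> locc (ds[i := e j]) ds' (\<Lambda> j)"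


section \<open>Genuine multipartite entanglement measures\<close>

text \<open>
  A measure is a family \<open>E\<close>: its member for \<open>k\<close> parties, \<open>E\<^sup>(\<^sup>k\<^sup>)\<close>, is the restriction of \<open>E\<close> to
  dimension lists of length \<open>k\<close>.
\<close>

type_synonym measure_family = "nat list \<Rightarrow> oper \<Rightarrow> real"

definition on_partition :: "measure_family \<Rightarrow> nat list \<Rightarrow> oper \<Rightarrow> nat set list \<Rightarrow> real" where
  "on_partition E ds \<rho> X = E (group_dims ds X) (group_state ds X \<rho>)"

text \<open>
  Positivity on genuinely entangled states is taken in its weak form (nonnegativity), which gives
  the larger class of measures.
\<close>

definition gmem :: "nat list \<Rightarrow> measure_family \<Rightarrow> bool" where
  "gmem ds E \<longleftrightarrow>
     (\<forall>\<rho>\<in>density_ops ds. 0 \<le> E ds \<rho>)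
   \<and> (\<forall>\<rho>\<in>density_ops ds. biseparable ds \<rho> \<longrightarrow> E ds \<rho> = 0)
   \<and> (\<forall>\<rho>\<in>density_ops ds. \<forall>\<sigma>\<in>density_ops ds. \<forall>t\<in>{0..1::real}.
        E ds (\<lambda>x y. of_real t * \<rho> x y + of_real (1 - t) * \<sigma> x y) \<le> t * E ds \<rho> + (1 - t) * E ds \<sigma>)
   \<and> (\<forall>\<rho>\<in>density_ops ds. \<forall>\<Lambda>. locc ds ds \<Lambda> \<longrightarrow> E ds (\<Lambda> \<rho>) \<le> E ds \<rho>)"

text \<open>
  That \<open>E\<^sup>(\<^sup>k\<^sup>)\<close> is determined along with \<open>E\<^sup>(\<^sup>m\<^sup>)\<close> is built into \<open>E\<close> being one single family; what remains
  is that its members with fewer parties are measures as well.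
\<close>

definition uniform_gmem :: "nat list \<Rightarrow> measure_family \<Rightarrow> bool" where
  "uniform_gmem ds E \<longleftrightarrow> gmem ds E \<and>
     (\<forall>X. party_partition ds X \<and> 2 \<le> length X \<and> length X < length ds \<longrightarrow> gmem (group_dims ds X) E)"

text \<open>Party \<open>i\<close> of the permuted system is party \<open>\<pi> i\<close> of the original one.\<close>

definition perm_invariant :: "nat list \<Rightarrow> measure_family \<Rightarrow> bool" where
  "perm_invariant ds E \<longleftrightarrow> (\<forall>\<pi> \<rho>. \<pi> permutes parties ds \<and> \<rho> \<in> density_ops ds \<longrightarrow>
     E (permute_list \<pi> ds) (\<lambda>x y. \<rho> (x \<circ> inv \<pi>) (y \<circ> inv \<pi>)) = E ds \<rho>)"

definition unified_gmem :: "nat list \<Rightarrow> measure_family \<Rightarrow> bool" where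
  "unified_gmem ds E \<longleftrightarrow> uniform_gmem ds E
   \<and> perm_invariant ds E
   \<and> (\<forall>X. party_partition ds X \<and> 2 \<le> length X \<longrightarrow> perm_invariant (group_dims ds X) E)
   \<and> (\<forall>\<rho>\<in>genuinely_entangled ds. \<forall>X Y.
        party_partition ds X \<and> party_partition ds Y \<and> 2 \<le> length Y \<and> X \<succ>a Y
        \<longrightarrow> on_partition E ds \<rho> X > on_partition E ds \<rho> Y)"

definition hierarchy_condition :: "nat list \<Rightarrow> measure_family \<Rightarrow> bool" where
  "hierarchy_condition ds E \<longleftrightarrow> (\<forall>\<rho>\<in>genuinely_entangled ds. \<forall>X Y.
     party_partition ds X \<and> party_partition ds Y \<and> 2 \<le> length Y \<and> X \<succ>b Y
     \<longrightarrow> on_partition E ds \<rho> X \<ge> on_partition E ds \<rho> Y)"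

definition complete_gmem :: "nat list \<Rightarrow> measure_family \<Rightarrow> bool" where
  "complete_gmem ds E \<longleftrightarrow> unified_gmem ds E \<and> hierarchy_condition ds E"

end

theory Submission
  imports Defs
begin

text \<open>
  The counterexample is the three-term state \<open>(|0\<dots>0\<rangle> + |1\<dots>1\<rangle> + |0\<dots>01\<rangle>)/\<surd>3\<close>. Its reduced
  state at the first party has purity \<open>5/9\<close>, the one at the last party has purity \<open>7/9\<close>. Hence
  \<open>C\<^sub>g\<^sub>m\<^sub>e\<close> is at most \<open>2/3\<close> for the finest partition, but \<open>2\<surd>2/3\<close> after all parties except the
  first one have been combined, since this removes the bipartition that cuts off the last party.
\<close>

section \<open>Purity of reduced pure states\<close>

lemma finite_basis [simp]: "finite S \<Longrightarrow> finite (basis ds S)"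
  by (simp add: basis_def finite_PiE)

lemma finite_parties [simp]: "finite (parties ds)"
  by (simp add: parties_def)

text \<open>A product-basis index amounts to its restrictions to \<open>S\<close> and to the other
  parties. Gluing them with \<open>override_on\<close> matches the form of
  \<open>reduced\<close>.\<close>

lemma sum_basis_split:
  fixes f :: "mindex \<Rightarrow> 'a::comm_monoid_add"
  assumes "S \<subseteq> parties ds"
  shows "(\<Sum>p\<in>basis ds (parties ds). f p) =
    (\<Sum>x\<in>basis ds S. \<Sum>z\<in>basis ds (parties ds - S). f (override_on z x S))"
proof -
  have "(\<Sum>p\<in>basis ds (parties ds). f p) =
     (\<Sum>(x, z)\<in>basis ds S \<times> basis ds (parties ds - S). f (override_on z x S))"
  proof (rule sum.reindex_bij_witness[where i = "\<lambda>(x, z). override_on z x S"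
        and j = "\<lambda>p. (restrict p S, restrict p (parties ds - S))"], goal_cases)
    case (1 p)
    then show ?case using assms
      by (auto simp: fun_eq_iff override_on_def basis_def PiE_iff extensional_def)
  next
    case (2 p)
    then show ?case using assms by (auto simp: basis_def)
  next
    case (3 q)
    then show ?case using assms
      by (auto simp: fun_eq_iff override_on_def basis_def PiE_iff extensional_def)
  next
    case (4 q)
    then show ?case using assms
      by (auto simp: override_on_def basis_def PiE_iff extensional_def)
  next
    case (5 p)
    then have "override_on (restrict p (parties ds - S)) (restrict p S) S = p" using assms
      by (auto simp: fun_eq_iff override_on_def basis_def PiE_iff extensional_def)
    then show ?case by simp
  qed
  then show ?thesis by (simp add: sum.cartesian_product)
qed

text \<open>The swap trick: the purity is the expectation of swapping \<open>S\<close> between two copies of \<open>\<psi>\<close>.\<close>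

lemma purity_reduced_proj:
  assumes "S \<subseteq> parties ds"
  shows "purity ds S (reduced ds S (proj \<psi>)) =
    Re (\<Sum>p\<in>basis ds (parties ds). \<Sum>r\<in>basis ds (parties ds).
      \<psi> p * \<psi> r * cnj (\<psi> (override_on p r S)) * cnj (\<psi> (override_on r p S)))"
proof -
  let ?A = "basis ds S" and ?C = "basis ds (parties ds - S)"
  let ?o = "\<lambda>z x. override_on z x S"
  \<comment> \<open>With \<open>p = ?o z x\<close> and \<open>r = ?o w y\<close>, this identifies
    \<open>override_on p r S\<close> as \<open>?o z y\<close>: the old values on \<open>S\<close>
    are forgotten.\<close>
  have o: "?o (?o z x) (?o w y) = ?o z y" for z x w y :: mindex
    by (auto simp: fun_eq_iff override_on_def)
  have "(\<Sum>x\<in>?A. \<Sum>y\<in>?A. reduced ds S (proj \<psi>) x y * reduced ds S (proj \<psi>) y x)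
      = (\<Sum>x\<in>?A. \<Sum>y\<in>?A. \<Sum>z\<in>?C. \<Sum>w\<in>?C.
          \<psi> (?o z x) * \<psi> (?o w y) * cnj (\<psi> (?o z y)) * cnj (\<psi> (?o w x)))"
    by (intro sum.cong refl) (simp add: reduced_def proj_def sum_product mult_ac)
  \<comment> \<open>The reordering puts \<open>x\<close> next to \<open>z\<close> and
    \<open>y\<close> next to \<open>w\<close>, so that each pair merges into one full index.\<close>
  also have "\<dots> = (\<Sum>x\<in>?A. \<Sum>z\<in>?C. \<Sum>y\<in>?A. \<Sum>w\<in>?C.
          \<psi> (?o z x) * \<psi> (?o w y) * cnj (\<psi> (?o z y)) * cnj (\<psi> (?o w x)))"
    by (intro sum.cong refl sum.swap)
  finally show ?thesis
    by (simp add: purity_def sum_basis_split[OF assms] o)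
qed

text \<open>Swapping outside \<open>S\<close> turns \<open>p\<close> into what swapping on
  \<open>S\<close> makes of \<open>r\<close>. The two conjugated factors of the swap formula merely
  trade places.\<close>

lemma purity_reduced_proj_complement:
  assumes "S \<subseteq> parties ds"
  shows "purity ds (parties ds - S) (reduced ds (parties ds - S) (proj \<psi>))
    = purity ds S (reduced ds S (proj \<psi>))"
proof -
  have "override_on p r (parties ds - S) = override_on r p S"
    if "p \<in> basis ds (parties ds)" "r \<in> basis ds (parties ds)" for p r
    using that assms by (auto simp: fun_eq_iff override_on_def basis_def PiE_iff extensional_def)
  then show ?thesis
    by (simp add: purity_reduced_proj assms mult_ac cong: sum.cong)
qed


section \<open>Pure states as density operators\<close>

lemma sum_mult_cnj_pure_state:
  assumes "\<psi> \<in> pure_states ds"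
  shows "(\<Sum>x\<in>basis ds (parties ds). \<psi> x * cnj (\<psi> x)) = 1"
proof -
  have "(\<Sum>x\<in>basis ds (parties ds). \<psi> x * cnj (\<psi> x))
      = of_real (\<Sum>x\<in>basis ds (parties ds). (cmod (\<psi> x))\<^sup>2)"
    unfolding of_real_sum complex_norm_square ..
  with assms show ?thesis by (simp add: pure_states_def)
qed

lemma proj_density_ops:
  assumes "\<psi> \<in> pure_states ds"
  shows "proj \<psi> \<in> density_ops ds"
proof -
  let ?B = "basis ds (parties ds)"
  have "(\<Sum>x\<in>?B. \<Sum>y\<in>?B. cnj (v x) * proj \<psi> x y * v y) \<in> \<real>\<^sub>\<ge>\<^sub>0" for v :: ket
  proof -
    define s where "s = (\<Sum>x\<in>?B. cnj (v x) * \<psi> x)"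
    have "(\<Sum>x\<in>?B. \<Sum>y\<in>?B. cnj (v x) * proj \<psi> x y * v y) = s * cnj s"
      by (simp add: s_def proj_def sum_product mult_ac)
    also have "\<dots> = of_real ((cmod s)\<^sup>2)"
      by (simp only: complex_norm_square)
    finally show ?thesis by simp
  qed
  moreover have "(\<Sum>x\<in>?B. proj \<psi> x x) = 1"
    using sum_mult_cnj_pure_state[OF assms] by (simp add: proj_def)
  ultimately show ?thesis
    using assms by (auto simp: density_ops_def positive_oper_def pure_states_def proj_def)
qed

section \<open>Rigidity of ensembles of a pure state\<close>

definition overlap :: "nat list \<Rightarrow> ket \<Rightarrow> ket \<Rightarrow> complex" where
  "overlap ds \<psi> \<phi> = (\<Sum>x\<in>basis ds (parties ds). cnj (\<psi> x) * \<phi> x)"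

text \<open>Pythagoras for the component of \<phi> orthogonal to \<psi>. It serves both as
  Cauchy-Schwarz and as its equality case.\<close>

lemma norm_diff_overlap:
  assumes "\<psi> \<in> pure_states ds" "\<phi> \<in> pure_states ds"
  shows "(\<Sum>x\<in>basis ds (parties ds). (cmod (\<phi> x - overlap ds \<psi> \<phi> * \<psi> x))\<^sup>2)
    = 1 - (cmod (overlap ds \<psi> \<phi>))\<^sup>2"
proof -
  let ?B = "basis ds (parties ds)" and ?c = "overlap ds \<psi> \<phi>"
  have n: "(\<Sum>x\<in>?B. \<psi> x * cnj (\<psi> x)) = 1" "(\<Sum>x\<in>?B. \<phi> x * cnj (\<phi> x)) = 1"
    using assms by (simp_all add: sum_mult_cnj_pure_state)
  have c: "(\<Sum>x\<in>?B. cnj (\<psi> x) * \<phi> x) = ?c" "(\<Sum>x\<in>?B. \<psi> x * cnj (\<phi> x)) = cnj ?c"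
    by (simp_all add: overlap_def)
  have "complex_of_real (\<Sum>x\<in>?B. (cmod (\<phi> x - ?c * \<psi> x))\<^sup>2)
    = (\<Sum>x\<in>?B. \<phi> x * cnj (\<phi> x) - cnj ?c * (cnj (\<psi> x) * \<phi> x) - ?c * (\<psi> x * cnj (\<phi> x))
        + ?c * cnj ?c * (\<psi> x * cnj (\<psi> x)))"
    unfolding of_real_sum complex_norm_square by (intro sum.cong refl) (simp add: algebra_simps)
  also have "\<dots> = 1 - ?c * cnj ?c"
    by (simp add: sum.distrib sum_subtractf n c flip: sum_distrib_left)
  also have "\<dots> = complex_of_real (1 - (cmod ?c)\<^sup>2)"
    by (simp only: of_real_diff complex_norm_square of_real_1)
  finally show ?thesis by (simp only: of_real_eq_iff)
qed

text \<open>Pure states are extreme: the squared overlaps with \<psi> are at most 1 and average to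
  1, so each one of positive weight equals 1. Then \<open>\<phi> i\<close> is a phase times \<psi>,
  and the phase drops out of the projector.\<close>

lemma pure_ensemble_proj_unique:
  assumes ens: "pure_ensemble ds (proj \<psi>) n p \<phi>" and psi: "\<psi> \<in> pure_states ds"
    and i: "i < n" "p i > 0"
  shows "proj (\<phi> i) = proj \<psi>"
proof -
  let ?B = "basis ds (parties ds)"
  let ?c = "\<lambda>i. overlap ds \<psi> (\<phi> i)"
  have p: "\<And>i. i < n \<Longrightarrow> 0 \<le> p i" "(\<Sum>i<n. p i) = 1"
    and phi: "\<And>i. i < n \<Longrightarrow> \<phi> i \<in> pure_states ds"
    and mix: "\<And>x y. \<psi> x * cnj (\<psi> y) = (\<Sum>i<n. of_real (p i) * (\<phi> i x * cnj (\<phi> i y)))"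
    using ens by (auto simp: pure_ensemble_def proj_def fun_eq_iff)
  have le1: "(cmod (?c i))\<^sup>2 \<le> 1" if "i < n" for i
  proof -
    have "0 \<le> (\<Sum>x\<in>?B. (cmod (\<phi> i x - ?c i * \<psi> x))\<^sup>2)"
      by (intro sum_nonneg) simp
    then show ?thesis using norm_diff_overlap[OF psi phi[OF that]] by simp
  qed
  have n1: "(\<Sum>x\<in>?B. cnj (\<psi> x) * \<psi> x) = 1"
    using sum_mult_cnj_pure_state[OF psi] by (simp add: mult.commute)
  \<comment> \<open>The expectation of \<open>proj \<psi>\<close> in \<psi> is 1; the chain
    evaluates it through the mixture.\<close>
  have "1 = (\<Sum>x\<in>?B. cnj (\<psi> x) * \<psi> x) * (\<Sum>y\<in>?B. cnj (\<psi> y) * \<psi> y)"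
    by (simp add: n1)
  also have "\<dots> = (\<Sum>x\<in>?B. \<Sum>y\<in>?B. cnj (\<psi> x) * (\<psi> x * cnj (\<psi> y)) * \<psi> y)"
    by (simp add: sum_product mult_ac)
  also have "\<dots> = (\<Sum>x\<in>?B. \<Sum>y\<in>?B. \<Sum>i<n.
      of_real (p i) * ((cnj (\<psi> x) * \<phi> i x) * cnj (cnj (\<psi> y) * \<phi> i y)))"
    unfolding mix by (simp add: sum_distrib_left sum_distrib_right mult_ac)
  also have "\<dots> = (\<Sum>x\<in>?B. \<Sum>i<n. \<Sum>y\<in>?B.
      of_real (p i) * ((cnj (\<psi> x) * \<phi> i x) * cnj (cnj (\<psi> y) * \<phi> i y)))"
    by (intro sum.cong refl sum.swap)
  also have "\<dots> = (\<Sum>i<n. \<Sum>x\<in>?B. \<Sum>y\<in>?B.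
      of_real (p i) * ((cnj (\<psi> x) * \<phi> i x) * cnj (cnj (\<psi> y) * \<phi> i y)))"
    by (rule sum.swap)
  also have "\<dots> = (\<Sum>i<n. of_real (p i) * (?c i * cnj (?c i)))"
    unfolding overlap_def cnj_sum sum_product by (simp add: sum_distrib_left)
  also have "\<dots> = complex_of_real (\<Sum>i<n. p i * (cmod (?c i))\<^sup>2)"
    by (simp only: of_real_sum of_real_mult complex_norm_square)
  finally have "(\<Sum>i<n. p i * (cmod (?c i))\<^sup>2) = 1"
    by (metis of_real_eq_1_iff)
  with p have "(\<Sum>i<n. p i * (1 - (cmod (?c i))\<^sup>2)) = 0"
    by (simp add: right_diff_distrib sum_subtractf)
  then have "\<forall>i\<in>{..<n}. p i * (1 - (cmod (?c i))\<^sup>2) = 0"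
    by (subst (asm) sum_nonneg_eq_0_iff) (use p le1 in auto)
  with i(1) have "p i * (1 - (cmod (?c i))\<^sup>2) = 0" by blast
  with i(2) have c1: "(cmod (?c i))\<^sup>2 = 1" by simp
  then have "(\<Sum>x\<in>?B. (cmod (\<phi> i x - ?c i * \<psi> x))\<^sup>2) = 0"
    using norm_diff_overlap[OF psi phi[OF i(1)]] by simp
  then have "\<forall>x\<in>?B. \<phi> i x = ?c i * \<psi> x"
    by (subst (asm) sum_nonneg_eq_0_iff) auto
  moreover have "\<phi> i x = ?c i * \<psi> x" if "x \<notin> ?B" for x
    using that psi phi[OF i(1)] by (auto simp: pure_states_def)
  ultimately have eq: "\<phi> i x = ?c i * \<psi> x" for x by blast
  have "?c i * cnj (?c i) = 1"
    using c1 by (metis complex_norm_square of_real_1)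
  moreover have "?c i * \<psi> x * cnj (?c i * \<psi> y) = (?c i * cnj (?c i)) * (\<psi> x * cnj (\<psi> y))" for x y
    by (simp add: mult_ac)
  ultimately have "?c i * \<psi> x * cnj (?c i * \<psi> y) = \<psi> x * cnj (\<psi> y)" for x y
    by simp
  then show ?thesis by (simp add: proj_def eq fun_eq_iff)
qed

text \<open>\<open>C_gme_pure\<close> sees a ket only through its projector, so every ensemble of
  \<open>proj \<psi>\<close> averages one and the same number. Members of weight zero may be
  arbitrary but contribute nothing.\<close>

lemma C_gme_proj:
  assumes psi: "\<psi> \<in> pure_states ds"
  shows "C_gme ds (proj \<psi>) = C_gme_pure ds \<psi>"
proof -
  have val: "(\<Sum>i<n. p i * C_gme_pure ds (\<phi> i)) = C_gme_pure ds \<psi>"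
    if ens: "pure_ensemble ds (proj \<psi>) n p \<phi>" for n p \<phi>
  proof -
    have "p i * C_gme_pure ds (\<phi> i) = p i * C_gme_pure ds \<psi>" if "i < n" for i
    proof (cases "p i = 0")
      case False
      with ens that have "p i > 0" by (auto simp: pure_ensemble_def less_le)
      from pure_ensemble_proj_unique[OF ens psi that this] show ?thesis
        by (simp add: C_gme_pure_def)
    qed simp
    then have "(\<Sum>i<n. p i * C_gme_pure ds (\<phi> i)) = (\<Sum>i<n. p i) * C_gme_pure ds \<psi>"
      unfolding sum_distrib_right by (intro sum.cong) auto
    then show ?thesis using ens by (simp add: pure_ensemble_def)
  qed
  \<comment> \<open>The one-member ensemble makes the set under the infimum nonempty, hence a
    singleton.\<close>
  have "pure_ensemble ds (proj \<psi>) 1 (\<lambda>_. 1) (\<lambda>_. \<psi>)"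
    using psi by (simp add: pure_ensemble_def)
  then have "\<exists>n p \<phi>. pure_ensemble ds (proj \<psi>) n p \<phi>" by blast
  then have "{(\<Sum>i<n. p i * C_gme_pure ds (\<phi> i)) | n p \<phi>. pure_ensemble ds (proj \<psi>) n p \<phi>}
      = {C_gme_pure ds \<psi>}"
    using val by (auto 0 0) metis
  then show ?thesis by (simp add: C_gme_def)
qed

text \<open>Reduces mixed biseparability to a single product vector. Equal projectors have equal
  diagonals, which preserves the zero pattern; the support argument for genuine entanglement needs
  no more.\<close>

lemma biseparable_proj_obtains:
  assumes "biseparable ds (proj \<psi>)" "\<psi> \<in> pure_states ds"
  obtains \<phi> where "biseparable_pure ds \<phi>" "\<And>x. \<phi> x = 0 \<longleftrightarrow> \<psi> x = 0"
proof -
  obtain n p \<phi> where ens: "pure_ensemble ds (proj \<psi>) n p \<phi>"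
    and bi: "\<forall>i<n. biseparable_pure ds (\<phi> i)"
    using assms(1) by (auto simp: biseparable_def)
  have "\<exists>i<n. p i > 0"
  proof (rule ccontr)
    assume "\<not> ?thesis"
    then have "(\<Sum>i<n. p i) \<le> 0" by (intro sum_nonpos) (meson lessThan_iff not_less)
    with ens show False by (simp add: pure_ensemble_def)
  qed
  then obtain i where i: "i < n" "p i > 0" by blast
  have "\<phi> i x * cnj (\<phi> i x) = \<psi> x * cnj (\<psi> x)" for x
    using pure_ensemble_proj_unique[OF ens assms(2) i] by (simp add: proj_def fun_eq_iff)
  then have "\<phi> i x = 0 \<longleftrightarrow> \<psi> x = 0" for x
    by (metis complex_cnj_zero_iff mult_eq_0_iff)
  with bi i show ?thesis using that by blast
qed


section \<open>Grouping parties\<close>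

text \<open>The ket counterpart of \<open>group_state\<close> when the blocks cover all parties:
  nothing is traced out and the amplitudes are only relabelled.\<close>

definition group_ket :: "nat list \<Rightarrow> nat set list \<Rightarrow> ket \<Rightarrow> ket" where
  "group_ket ds X \<psi> = (\<lambda>x. if x \<in> basis (group_dims ds X) (parties (group_dims ds X))
     then \<psi> (ungroup ds X x) else 0)"

locale full_partition =
  fixes ds :: "nat list" and X :: "nat set list"
  assumes party_partition: "party_partition ds X" and Union_blocks: "\<Union>(set X) = parties ds"
begin

abbreviation "G \<equiv> basis (group_dims ds X) (parties (group_dims ds X))"
abbreviation "B \<equiv> basis ds (parties ds)"

lemma parties_group_dims: "parties (group_dims ds X) = {..<length X}"
  by (simp add: parties_def group_dims_def)

lemma block_index_eq:
  assumes "j < length X" "i \<in> X ! j"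
  shows "block_index X i = j"
  unfolding block_index_def
proof (rule the_equality)
  fix k assume k: "k < length X \<and> i \<in> X ! k"
  with assms party_partition have "X ! k = X ! j"
    by (meson disjointD disjoint_iff nth_mem partition_onD2 party_partition_def)
  with k assms party_partition show "k = j"
    by (simp add: nth_eq_iff_index_eq party_partition_def)
qed (use assms in simp)

lemma block_index:
  assumes "i \<in> parties ds"
  shows "block_index X i < length X" "i \<in> X ! block_index X i"
  using assms block_index_eq unfolding Union_blocks[symmetric] by (auto simp: in_set_conv_nth)

lemma finite_block: "j < length X \<Longrightarrow> finite (X ! j)"
  using Union_blocks by (metis Union_upper finite_parties finite_subset nth_mem)

lemma block_subset: "j < length X \<Longrightarrow> X ! j \<subseteq> parties ds"
  using Union_blocks by (metis Union_upper nth_mem)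

text \<open>The dimension of a block is the number of its product basis vectors, so each coordinate
  ranges exactly over the domain of the enumeration \<open>from_nat_into\<close>.\<close>

lemma G_eq: "G = (\<Pi>\<^sub>E j\<in>{..<length X}. {..<card (basis ds (X ! j))})"
  unfolding basis_def parties_group_dims
  by (intro PiE_cong) (simp add: group_dims_def card_PiE finite_block)

lemma bij_from_nat_into:
  "j < length X \<Longrightarrow> bij_betw (from_nat_into (basis ds (X ! j)))
     {..<card (basis ds (X ! j))} (basis ds (X ! j))"
  by (intro bij_betw_from_nat_into_finite finite_basis finite_block)

lemma from_nat_into_block:
  assumes "x \<in> G" "j < length X"
  shows "from_nat_into (basis ds (X ! j)) (x j) \<in> basis ds (X ! j)"
  using assms bij_from_nat_into[of j] unfolding G_eq
  by (auto simp: PiE_iff dest: bij_betw_apply)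

lemma ungroup_block:
  assumes "j < length X" "i \<in> X ! j"
  shows "ungroup ds X x i = from_nat_into (basis ds (X ! j)) (x j) i"
  using assms block_index_eq[OF assms] block_subset[OF assms(1)]
  by (auto simp: ungroup_def Union_blocks)

text \<open>A grouped index chooses one basis vector per block, and disjoint blocks covering all
  parties glue these choices to one full index without loss.\<close>

lemma bij_ungroup: "bij_betw (ungroup ds X) G B"
proof (rule bij_betw_imageI)
  show "inj_on (ungroup ds X) G"
  proof (rule inj_onI)
    fix x y assume xy: "x \<in> G" "y \<in> G" and eq: "ungroup ds X x = ungroup ds X y"
    have "x j = y j" if j: "j < length X" for j
    proof -
      let ?f = "from_nat_into (basis ds (X ! j))"
      have "?f (x j) i = ?f (y j) i" for i
      proof (cases "i \<in> X ! j")
        case True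
        then show ?thesis using eq ungroup_block[OF j] by metis
      next
        \<comment> \<open>Outside the block both basis vectors are \<open>undefined\<close> by
          extensionality.\<close>
        case False
        then show ?thesis using from_nat_into_block[OF xy(1) j] from_nat_into_block[OF xy(2) j]
          by (simp add: basis_def PiE_iff extensional_def)
      qed
      then have "?f (x j) = ?f (y j)" by blast
      with bij_from_nat_into[OF j] xy j show ?thesis
        unfolding G_eq by (auto simp: PiE_iff bij_betw_def dest!: inj_onD)
    qed
    with xy show "x = y" unfolding G_eq by (intro PiE_ext[of x _ _ y]) auto
  qed
  show "ungroup ds X ` G = B"
  proof (intro equalityI subsetI)
    fix u assume "u \<in> ungroup ds X ` G"
    then obtain x where x: "x \<in> G" "u = ungroup ds X x" by blast
    have "u i < ds ! i" if "i \<in> parties ds" for i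
      using from_nat_into_block[OF x(1) block_index(1)[OF that]] block_index[OF that]
      by (simp add: x(2) ungroup_block basis_def PiE_iff)
    then show "u \<in> B" by (auto simp: basis_def PiE_iff x(2) ungroup_def Union_blocks)
  next
    fix u assume u: "u \<in> B"
    \<comment> \<open>The preimage records, for each block, the number of the restriction of
      \<open>u\<close> in the enumeration.\<close>
    define x where
      "x = (\<lambda>j\<in>{..<length X}. to_nat_on (basis ds (X ! j)) (restrict u (X ! j)))"
    have res: "restrict u (X ! j) \<in> basis ds (X ! j)" if "j < length X" for j
      using u block_subset[OF that] by (auto simp: basis_def)
    have "x \<in> G" unfolding G_eq x_def
      using bij_betw_apply[OF to_nat_on_finite[OF finite_basis[OF finite_block]] res] by auto
    moreover have "ungroup ds X x = u"
    proof
      fix i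
      show "ungroup ds X x i = u i"
      proof (cases "i \<in> parties ds")
        case True
        note j = block_index[OF True]
        show ?thesis
          by (simp add: ungroup_block[OF j] x_def j res countable_finite finite_block)
      next
        case False
        then show ?thesis using u
          by (simp add: ungroup_def Union_blocks basis_def PiE_iff extensional_def)
      qed
    qed
    ultimately show "u \<in> ungroup ds X ` G" by blast
  qed
qed

text \<open>Lets the swap formula pass through the relabelling: exchanging grouped coordinates
  exchanges whole blocks of parties.\<close>

lemma ungroup_override:
  assumes "S \<subseteq> {..<length X}"
  shows "ungroup ds X (override_on x y S) =
    override_on (ungroup ds X x) (ungroup ds X y) (\<Union>j\<in>S. X ! j)"
proof
  fix i
  show "ungroup ds X (override_on x y S) i =
    override_on (ungroup ds X x) (ungroup ds X y) (\<Union>j\<in>S. X ! j) i"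
  proof (cases "i \<in> parties ds")
    case True
    have "block_index X i \<in> S \<longleftrightarrow> i \<in> (\<Union>j\<in>S. X ! j)"
      using block_index[OF True] block_index_eq assms by blast
    then show ?thesis by (auto simp: ungroup_def override_on_def)
  next
    case False
    then show ?thesis by (simp add: ungroup_def Union_blocks override_on_def)
  qed
qed

lemma override_on_G:
  assumes "x \<in> G" "y \<in> G" "S \<subseteq> {..<length X}"
  shows "override_on x y S \<in> G"
  using assms unfolding G_eq by (auto simp: PiE_iff override_on_def extensional_def)

lemma group_ket_pure_states:
  assumes "\<psi> \<in> pure_states ds"
  shows "group_ket ds X \<psi> \<in> pure_states (group_dims ds X)"
  using assms sum.reindex_bij_betw[OF bij_ungroup, of "\<lambda>x. (cmod (\<psi> x))\<^sup>2"]
  by (simp add: pure_states_def group_ket_def cong: sum.cong)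

lemma group_state_proj:
  "group_state ds X (proj \<psi>) = proj (group_ket ds X \<psi>)"
proof -
  \<comment> \<open>With all parties kept, the partial trace runs over the single index in
    \<open>basis ds {}\<close> and changes nothing.\<close>
  have "override_on z x (parties ds) = x" if "x \<in> B" "z \<in> basis ds {}" for x z
    using that by (auto simp: fun_eq_iff override_on_def basis_def PiE_iff extensional_def)
  then have "reduced ds (parties ds) (proj \<psi>) x y = proj \<psi> x y" if "x \<in> B" "y \<in> B" for x y
    using that by (simp add: reduced_def cong: sum.cong) (simp add: basis_def)
  then show ?thesis
    using bij_betw_apply[OF bij_ungroup]
    by (auto simp: group_state_def proj_def group_ket_def Union_blocks fun_eq_iff Let_def)
qed

text \<open>The swap formula is transported along the bijection \<open>ungroup\<close>, once for
  each of its two summation indices.\<close>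

lemma purity_group_ket:
  assumes "S \<subseteq> {..<length X}"
  shows "purity (group_dims ds X) S (reduced (group_dims ds X) S (proj (group_ket ds X \<psi>)))
    = purity ds (\<Union>j\<in>S. X ! j) (reduced ds (\<Union>j\<in>S. X ! j) (proj \<psi>))"
proof -
  let ?U = "\<Union>j\<in>S. X ! j" and ?u = "ungroup ds X"
  have U: "?U \<subseteq> parties ds" using assms block_subset by blast
  have "(\<Sum>p\<in>G. \<Sum>r\<in>G. group_ket ds X \<psi> p * group_ket ds X \<psi> r
        * cnj (group_ket ds X \<psi> (override_on p r S)) * cnj (group_ket ds X \<psi> (override_on r p S)))
      = (\<Sum>p\<in>G. \<Sum>r\<in>G. \<psi> (?u p) * \<psi> (?u r)
        * cnj (\<psi> (override_on (?u p) (?u r) ?U)) * cnj (\<psi> (override_on (?u r) (?u p) ?U)))"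
    by (intro sum.cong refl) (simp add: group_ket_def override_on_G assms ungroup_override)
  also have "\<dots> = (\<Sum>p\<in>G. \<Sum>r\<in>B. \<psi> (?u p) * \<psi> r
        * cnj (\<psi> (override_on (?u p) r ?U)) * cnj (\<psi> (override_on r (?u p) ?U)))"
    by (intro sum.cong refl sum.reindex_bij_betw[OF bij_ungroup])
  also have "\<dots> = (\<Sum>p\<in>B. \<Sum>r\<in>B. \<psi> p * \<psi> r
        * cnj (\<psi> (override_on p r ?U)) * cnj (\<psi> (override_on r p ?U)))"
    by (rule sum.reindex_bij_betw[OF bij_ungroup])
  finally show ?thesis
    using assms by (simp add: purity_reduced_proj U parties_group_dims)
qed

text \<open>The minimum runs over those cuts of the original system that split no block. Combining
  blocks therefore only removes candidates, which can raise the minimum; this is the source of the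
  violation.\<close>

lemma on_partition_C_gme_proj:
  assumes "\<psi> \<in> pure_states ds"
  shows "on_partition C_gme ds (proj \<psi>) X =
    Min ((\<lambda>S. sqrt (2 * (1 - purity ds (\<Union>j\<in>S. X ! j) (reduced ds (\<Union>j\<in>S. X ! j) (proj \<psi>)))))
      ` {S. S \<noteq> {} \<and> S \<subset> {..<length X}})"
  unfolding on_partition_def group_state_proj C_gme_proj[OF group_ket_pure_states[OF assms]]
    C_gme_pure_def bipartitions_def parties_group_dims
  by (intro arg_cong[where f = Min] image_cong) (auto simp: purity_group_ket)

end


section \<open>The three-term state\<close>

definition uniform3 :: "mindex set \<Rightarrow> ket" where
  "uniform3 T = (\<lambda>x. if x \<in> T then complex_of_real (1 / sqrt 3) else 0)"

lemma uniform3_pure_states: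
  assumes "T \<subseteq> basis ds (parties ds)" "card T = 3"
  shows "uniform3 T \<in> pure_states ds"
proof -
  have "(\<Sum>x\<in>basis ds (parties ds). (cmod (uniform3 T x))\<^sup>2) = (\<Sum>x\<in>T. (cmod (uniform3 T x))\<^sup>2)"
    using assms by (intro sum.mono_neutral_right) (auto simp: uniform3_def)
  also have "\<dots> = (\<Sum>x\<in>T. 1 / 3)"
    by (intro sum.cong refl) (simp add: uniform3_def norm_divide power_divide)
  finally show ?thesis using assms by (auto simp: pure_states_def uniform3_def)
qed

text \<open>All amplitudes on \<open>T\<close> equal \<open>1 / sqrt 3\<close>, so each pair whose
  swap stays inside \<open>T\<close> contributes its fourth power, and purity becomes a count of
  pairs.\<close>

lemma purity_uniform3:
  assumes "T \<subseteq> basis ds (parties ds)" "S \<subseteq> parties ds"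
  shows "purity ds S (reduced ds S (proj (uniform3 T))) =
    (\<Sum>p\<in>T. \<Sum>r\<in>T. if override_on p r S \<in> T \<and> override_on r p S \<in> T then 1 / 9 else 0)"
proof -
  let ?B = "basis ds (parties ds)"
  let ?f = "\<lambda>p r. uniform3 T p * uniform3 T r * cnj (uniform3 T (override_on p r S))
     * cnj (uniform3 T (override_on r p S))"
  define k where "k = complex_of_real (1 / sqrt 3)"
  have k2: "k * k = 1 / 3" by (simp add: k_def flip: of_real_mult)
  have k: "k * k * k * k = 1 / 9" unfolding k2 mult.assoc by simp
  have u: "uniform3 T x = (if x \<in> T then k else 0)" for x
    by (simp add: uniform3_def k_def)
  have [simp]: "cnj k = k" by (simp add: k_def)
  have "?f p r =
      of_real (if override_on p r S \<in> T \<and> override_on r p S \<in> T then 1 / 9 else 0)"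
    if "p \<in> T" "r \<in> T" for p r
    using that by (simp add: u k)
  moreover have "(\<Sum>p\<in>?B. \<Sum>r\<in>?B. ?f p r) = (\<Sum>p\<in>T. \<Sum>r\<in>T. ?f p r)"
  proof -
    have "(\<Sum>r\<in>?B. ?f p r) = (\<Sum>r\<in>T. ?f p r)" for p
      using assms by (intro sum.mono_neutral_right) (auto simp: uniform3_def)
    moreover have "(\<Sum>p\<in>?B. \<Sum>r\<in>T. ?f p r) = (\<Sum>p\<in>T. \<Sum>r\<in>T. ?f p r)"
      using assms by (intro sum.mono_neutral_right) (auto simp: uniform3_def)
    ultimately show ?thesis by simp
  qed
  ultimately show ?thesis
    unfolding purity_reduced_proj[OF assms(2)] by (simp flip: of_real_sum)
qed

section \<open>The concrete state and its purities at the first and last party\<close>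

definition all_0 :: "nat \<Rightarrow> mindex" where
  "all_0 m = (\<lambda>i\<in>{..<m}. 0)"

definition all_1 :: "nat \<Rightarrow> mindex" where
  "all_1 m = (\<lambda>i\<in>{..<m}. 1)"

definition last_1 :: "nat \<Rightarrow> mindex" where
  "last_1 m = (\<lambda>i\<in>{..<m}. if i = m - 1 then 1 else 0)"

text \<open>The three indices are restricted to \<open>{..<m}\<close> since members of
  \<open>basis\<close> must be \<open>undefined\<close> elsewhere.\<close>

definition support3 :: "nat \<Rightarrow> mindex set" where
  "support3 m = {all_0 m, all_1 m, last_1 m}"

definition ket3 :: "nat \<Rightarrow> ket" where
  "ket3 m = uniform3 (support3 m)"

lemma ket3_eq_0_iff: "ket3 m x = 0 \<longleftrightarrow> x \<notin> support3 m"
  by (simp add: ket3_def uniform3_def)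

lemma support3_apply:
  assumes "i < m"
  shows "all_0 m i = 0" "all_1 m i = 1" "last_1 m i = (if i = m - 1 then 1 else 0)"
  using assms by (simp_all add: all_0_def all_1_def last_1_def)

lemma support3_distinct:
  assumes "m \<ge> 2"
  shows "all_0 m \<noteq> all_1 m" "all_0 m \<noteq> last_1 m" "all_1 m \<noteq> last_1 m"
proof -
  have "0 < m" "m - 1 < m" "0 \<noteq> m - 1" using assms by auto
  then show "all_0 m \<noteq> all_1 m" "all_0 m \<noteq> last_1 m" "all_1 m \<noteq> last_1 m"
    by (metis support3_apply zero_neq_one)+
qed

lemma support3_subset_basis:
  assumes "\<forall>d\<in>set ds. d \<ge> 2"
  shows "support3 (length ds) \<subseteq> basis ds (parties ds)"
proof -
  have "ds ! i \<ge> 2" if "i < length ds" for i using assms that by simp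
  then have "0 < ds ! i \<and> 1 < ds ! i" if "i < length ds" for i
    using that by (metis less_le_trans one_less_numeral_iff semiring_norm(76) zero_less_numeral)
  then show ?thesis
    by (auto simp: support3_def all_0_def all_1_def last_1_def basis_def parties_def PiE_iff)
qed

lemma ket3_pure_states:
  assumes "length ds \<ge> 2" "\<forall>d\<in>set ds. d \<ge> 2"
  shows "ket3 (length ds) \<in> pure_states ds"
  unfolding ket3_def
  using support3_subset_basis[OF assms(2)] support3_distinct[OF assms(1)]
  by (intro uniform3_pure_states) (auto simp: support3_def)

lemma sum_support3:
  fixes f :: "mindex \<Rightarrow> real"
  assumes "m \<ge> 2"
  shows "(\<Sum>x\<in>support3 m. f x) = f (all_0 m) + f (all_1 m) + f (last_1 m)"
  using support3_distinct[OF assms] by (simp add: support3_def)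

lemma override_on_same [simp]: "override_on p p S = p"
  by (simp add: override_on_def)

text \<open>Exactly five of the nine pairs agree at party 0: the three diagonal ones and
  \<open>all_0\<close> with \<open>last_1\<close> in both orders. Only these survive the
  swap.\<close>

lemma purity_ket3_first:
  assumes "length ds \<ge> 3" "\<forall>d\<in>set ds. d \<ge> 2"
  shows "purity ds {0} (reduced ds {0} (proj (ket3 (length ds)))) = 5 / 9"
proof -
  let ?m = "length ds"
  have m: "0 < ?m" "1 < ?m" "0 \<noteq> ?m - 1" "1 \<noteq> ?m - 1" using assms by auto
  \<comment> \<open>Party 1 is not the last one, so support indices agree at parties 0 and 1; the
    overridden index does not.\<close>
  have notin: "override_on p r {0} \<notin> support3 ?m" if "p 1 \<noteq> r 0" for p r
  proof -
    have "x 0 = x 1" if "x \<in> support3 ?m" for x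
      using that m by (auto simp: support3_def support3_apply simp del: One_nat_def)
    from this[of "override_on p r {0}"] that show ?thesis by auto
  qed
  have same: "override_on p r {0} = p" if "p 0 = r 0" for p r :: mindex
    using that by (auto simp: override_on_def fun_eq_iff)
  have S: "{0} \<subseteq> parties ds" using m by (simp add: parties_def)
  have mem: "all_0 ?m \<in> support3 ?m" "all_1 ?m \<in> support3 ?m" "last_1 ?m \<in> support3 ?m"
    by (simp_all add: support3_def)
  show ?thesis
    unfolding ket3_def purity_uniform3[OF support3_subset_basis[OF assms(2)] S]
    using assms(1) m by (simp add: sum_support3 notin same mem support3_apply)
qed

text \<open>Only \<open>all_0\<close> paired with \<open>all_1\<close>, in either order, leaves the
  support: one of the swapped indices is 1\<dots>10. Seven of nine pairs remain.\<close>

lemma purity_ket3_last: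
  assumes "length ds \<ge> 3" "\<forall>d\<in>set ds. d \<ge> 2"
  shows "purity ds {length ds - 1} (reduced ds {length ds - 1} (proj (ket3 (length ds)))) = 7 / 9"
proof -
  let ?m = "length ds"
  have m: "0 < ?m" "0 \<noteq> ?m - 1" "?m - 1 < ?m" using assms by auto
  have notin: "override_on (all_1 ?m) (all_0 ?m) {?m - 1} \<notin> support3 ?m" (is "?x \<notin> _")
  proof -
    have "x (?m - 1) = 1" if "x \<in> support3 ?m" "x 0 = 1" for x
      using that m by (auto simp: support3_def support3_apply simp del: One_nat_def)
    moreover have "?x 0 = 1" "?x (?m - 1) = 0"
      using m by (simp_all add: support3_apply del: One_nat_def)
    ultimately show ?thesis by (metis zero_neq_one)
  qed
  have ov: "override_on (all_0 ?m) (last_1 ?m) {?m - 1} = last_1 ?m"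
    "override_on (last_1 ?m) (all_0 ?m) {?m - 1} = all_0 ?m"
    "override_on (all_1 ?m) (last_1 ?m) {?m - 1} = all_1 ?m"
    "override_on (last_1 ?m) (all_1 ?m) {?m - 1} = last_1 ?m"
    using m by (auto simp: override_on_def fun_eq_iff all_0_def all_1_def last_1_def)
  have S: "{?m - 1} \<subseteq> parties ds" using m by (simp add: parties_def)
  have mem: "all_0 ?m \<in> support3 ?m" "all_1 ?m \<in> support3 ?m" "last_1 ?m \<in> support3 ?m"
    by (simp_all add: support3_def)
  show ?thesis
    unfolding ket3_def purity_uniform3[OF support3_subset_basis[OF assms(2)] S]
    using assms(1) by (simp add: sum_support3 notin ov mem del: One_nat_def)
qed

text \<open>
  If a product vector across \<open>S\<close> has \<open>0\<dots>0\<close> and \<open>1\<dots>1\<close> in its support, then also the two indices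
  obtained by exchanging the values on \<open>S\<close>. In \<open>support3\<close> both of them would have to be \<open>0\<dots>01\<close>.
\<close>

lemma ket3_not_biseparable:
  assumes "length ds \<ge> 2" "\<forall>d\<in>set ds. d \<ge> 2"
  shows "\<not> biseparable ds (proj (ket3 (length ds)))"
proof
  let ?m = "length ds"
  let ?a = "all_0 ?m" and ?b = "all_1 ?m"
  assume "biseparable ds (proj (ket3 ?m))"
  then obtain \<phi> where bi: "biseparable_pure ds \<phi>" and "\<And>x. \<phi> x = 0 \<longleftrightarrow> ket3 ?m x = 0"
    using biseparable_proj_obtains ket3_pure_states[OF assms] by blast
  then have supp: "\<phi> x \<noteq> 0 \<longleftrightarrow> x \<in> support3 ?m" for x
    by (simp add: ket3_eq_0_iff)
  obtain S \<alpha> \<beta> where S: "S \<noteq> {}" "S \<subset> parties ds"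
    and prod: "\<And>x. x \<in> basis ds (parties ds) \<Longrightarrow>
      \<phi> x = \<alpha> (restrict x S) * \<beta> (restrict x (parties ds - S))"
    using bi unfolding biseparable_pure_def bipartitions_def by blast
  \<comment> \<open>The two factors at the mixed index already occur in the nonzero amplitudes of
    \<open>y\<close> and \<open>x\<close>, so neither vanishes.\<close>
  have cross: "override_on x y S \<in> support3 ?m"
    if xy: "x \<in> support3 ?m" "y \<in> support3 ?m" for x y
  proof -
    have B: "x \<in> basis ds (parties ds)" "y \<in> basis ds (parties ds)"
      using support3_subset_basis[OF assms(2)] xy by blast+
    then have "override_on x y S \<in> basis ds (parties ds)"
      using S(2) by (auto simp: basis_def PiE_iff override_on_def extensional_def)
    moreover have "restrict (override_on x y S) S = restrict y S"
      "restrict (override_on x y S) (parties ds - S) = restrict x (parties ds - S)"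
      by (auto simp: fun_eq_iff override_on_def restrict_def)
    ultimately have "\<phi> (override_on x y S)
        = \<alpha> (restrict y S) * \<beta> (restrict x (parties ds - S))"
      using prod by metis
    moreover have "\<alpha> (restrict y S) \<noteq> 0" "\<beta> (restrict x (parties ds - S)) \<noteq> 0"
      using xy prod[OF B(1)] prod[OF B(2)] supp by (metis mult_zero_left mult_zero_right)+
    ultimately show ?thesis using supp by (metis mult_eq_0_iff)
  qed
  obtain i j where ij: "i \<in> S" "j \<in> parties ds" "j \<notin> S" using S by blast
  then have im: "i < ?m" "j < ?m" using S by (auto simp: parties_def)
  have "override_on ?a ?b S \<in> support3 ?m" "override_on ?b ?a S \<in> support3 ?m"
    by (intro cross; simp add: support3_def)+
  moreover have "override_on ?a ?b S i = 1" "override_on ?a ?b S j = 0"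
    "override_on ?b ?a S i = 0" "override_on ?b ?a S j = 1"
    using ij im by (simp_all add: support3_apply)
  \<comment> \<open>Each mixed index takes both values 0 and 1, at \<open>i\<close> and
    \<open>j\<close>, and so is neither constant index. Yet the two differ at
    \<open>i\<close>.\<close>
  ultimately have "override_on ?a ?b S = last_1 ?m" "override_on ?b ?a S = last_1 ?m"
    unfolding support3_def using im by (auto simp: support3_apply)
  then have "last_1 ?m i = 1" "last_1 ?m i = 0"
    using \<open>override_on ?a ?b S i = 1\<close> \<open>override_on ?b ?a S i = 0\<close> by simp_all
  then show False by simp
qed

section \<open>The finest partition against the first party versus the rest\<close>

theorem mainTheorem4:
  fixes ds :: "nat list"
  assumes "length ds \<ge> 3" and "\<forall>d\<in>set ds. d \<ge> 2"
  shows "\<not> hierarchy_condition ds C_gme \<and> \<not> complete_gmem ds C_gme"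
proof -
  let ?m = "length ds"
  define \<rho> where "\<rho> = proj (ket3 ?m)"
  define X where "X = map (\<lambda>i. {i}) [0..<?m]"
  define Y where "Y = [{0}, parties ds - {0}]"
  have m: "0 < ?m" "1 < ?m" "2 < ?m" "?m - 1 < ?m" "2 \<le> ?m" using assms by auto
  have pure: "ket3 ?m \<in> pure_states ds" using ket3_pure_states[OF m(5) assms(2)] .
  have ge: "\<rho> \<in> genuinely_entangled ds"
    using proj_density_ops[OF pure] ket3_not_biseparable[OF m(5) assms(2)]
    by (simp add: genuinely_entangled_def \<rho>_def)
  have setX: "set X = (\<lambda>i. {i}) ` parties ds" by (auto simp: X_def parties_def)
  have mem: "0 \<in> parties ds" "1 \<in> parties ds" "2 \<in> parties ds"
    using m by (auto simp: parties_def)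
  interpret X: full_partition ds X
  proof
    have "distinct X" by (simp add: X_def distinct_map inj_on_def)
    then show "party_partition ds X"
      by (auto simp: party_partition_def partition_on_def setX disjoint_def)
  qed (auto simp: setX)
  interpret Y: full_partition ds Y
  proof
    show "party_partition ds Y"
      using mem by (auto simp: party_partition_def partition_on_def Y_def disjoint_def)
  qed (use mem in \<open>auto simp: Y_def\<close>)
  have combines: "X \<succ>b Y"
    unfolding combines_def
  proof
    have "\<forall>A\<in>set X. \<exists>C\<in>set Y. A \<subseteq> C" by (auto simp: setX Y_def)
    then show "refines (\<Union>(set X)) (set X) (set Y)"
      using X.party_partition Y.party_partition X.Union_blocks Y.Union_blocks
      by (simp add: refines_def party_partition_def)
    \<comment> \<open>With at least three parties the remainder is no singleton, so \<open>Y\<close>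
      is strictly coarser than \<open>X\<close>.\<close>
    have "parties ds - {0} \<notin> set X"
    proof
      assume "parties ds - {0} \<in> set X"
      then obtain i where "parties ds - {0} = {i}" by (auto simp: setX)
      moreover have "1 \<in> parties ds - {0}" "2 \<in> parties ds - {0}" using mem by auto
      ultimately show False by simp
    qed
    then show "set X \<noteq> set Y" by (auto simp: Y_def)
  qed
  \<comment> \<open>The cut isolating the last party bounds the minimum, and
    \<open>4 / 9 = 2 * (1 - 7 / 9)\<close>.\<close>
  have "on_partition C_gme ds \<rho> X \<le> sqrt (4 / 9)"
  proof -
    let ?f = "\<lambda>S. sqrt (2 * (1 - purity ds (\<Union>j\<in>S. X ! j)
      (reduced ds (\<Union>j\<in>S. X ! j) (proj (ket3 ?m)))))"
    have "0 \<in> {..<length X}" "0 \<notin> {?m - 1}" using m by (auto simp: X_def)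
    moreover have "{?m - 1} \<subseteq> {..<length X}" using m by (simp add: X_def)
    ultimately have "{?m - 1} \<in> {S. S \<noteq> {} \<and> S \<subset> {..<length X}}" by blast
    moreover have "finite {S. S \<noteq> {} \<and> S \<subset> {..<length X}}"
      by (rule finite_subset[of _ "Pow {..<length X}"]) auto
    ultimately have "Min (?f ` {S. S \<noteq> {} \<and> S \<subset> {..<length X}}) \<le> ?f {?m - 1}"
      by (metis (no_types, lifting) Min_le finite_imageI imageI)
    also have "(\<Union>j\<in>{?m - 1}. X ! j) = {?m - 1}" using m by (simp add: X_def)
    finally show ?thesis
      unfolding \<rho>_def X.on_partition_C_gme_proj[OF pure]
      by (simp add: purity_ket3_last[OF assms] del: One_nat_def)
  qed
  also have "\<dots> < sqrt (8 / 9)" by simp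
  also have "\<dots> \<le> on_partition C_gme ds \<rho> Y"
  proof -
    \<comment> \<open>Two blocks admit a single bipartition, listed by both of its sides; these have
      equal purity, and \<open>8 / 9 = 2 * (1 - 5 / 9)\<close>.\<close>
    let ?P = "{S. S \<noteq> {} \<and> S \<subset> {..<length Y}}"
    have "{..<length Y} = {0, 1}" by (auto simp: Y_def)
    then have P: "?P = {{0}, {1}}" unfolding psubset_eq Pow_iff[symmetric] by (auto simp: Pow_insert)
    have val: "purity ds (\<Union>j\<in>S. Y ! j) (reduced ds (\<Union>j\<in>S. Y ! j) (proj (ket3 ?m))) = 5 / 9"
      if "S \<in> ?P" for S
      using that purity_reduced_proj_complement[of "{0}" ds] purity_ket3_first[OF assms] mem
      unfolding P by (auto simp: Y_def)
    show ?thesis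
      unfolding \<rho>_def Y.on_partition_C_gme_proj[OF pure]
      using val[of "{0}"] val[of "{1}"] unfolding P by simp
  qed
  finally have "on_partition C_gme ds \<rho> X < on_partition C_gme ds \<rho> Y" .
  moreover have "2 \<le> length Y" by (simp add: Y_def)
  ultimately have "\<not> hierarchy_condition ds C_gme"
    using ge combines X.party_partition Y.party_partition
    unfolding hierarchy_condition_def by (meson not_less)
  then show ?thesis by (simp add: complete_gmem_def)
qed

end
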